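(* Let $\mathcal{A}$ be an abelian category and let $C_\bullet=(\cdots\to C_{n+1}\xrightarrow{d_{n+1}}C_n\xrightarrow{d_n}C_{n-1}\to\cdots)$ be a complex in $\mathcal{A}$. Then, for every $n$, the right homology module $\mathcal{H}^R_n(C_\bullet)$ is represented on the class of projective objects of $\mathcal{A}$ by the usual homology object $H_n(C_\bullet)$; that is, the restriction of the functor $\mathcal{H}^R_n(C_\bullet):\mathcal{A}^{op}\to\mathbf{Ab}$ to the full subcategory of projective objects of $\mathcal{A}$ is isomorphic to the restriction of $\mathrm{Hom}_{\mathcal{A}}(\cdot,H_n(C_\bullet))$: there are isomorphisms of abelian groups $\mathcal{H}^R_n(C_\bullet)(P)\cong \mathrm{Hom}_{\mathcal{A}}(P,H_n(C_\bullet))$, natural in the projective object $P$.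
   Context: For a morphism $f:A\to B$ in $\mathcal{A}$ and an object $X$ define the abelian groups: $\mathrm{Ker}(f)(X)=\{\varphi:X\to A\mid f\circ\varphi=0\}$ (the kernel ideal of $f$, based at the domain $A$); $\mathrm{Coker}(f)(X)=\{\psi:B\to X\mid \psi\circ f=0\}$ (the cokernel ideal of $f$, based at the codomain $B$); $\mathrm{Im}(f)(X)=\{\varphi:X\to B\mid \psi\circ\varphi=0 \text{ for every object } Y \text{ and every } \psi\in\mathrm{Coker}(f)(Y)\}$ (the image ideal of $f$, based at the codomain $B$). $\mathrm{Ker}(f)$ and $\mathrm{Im}(f)$ are contravariant additive functors of $X$ (subfunctors of $\mathrm{Hom}(\cdot,A)$ and $\mathrm{Hom}(\cdot,B)$ respectively, via precomposition). For a complex $C_\bullet$ (so $d_n\circ d_{n+1}=0$) one has $\mathrm{Im}(d_{n+1})\subset\mathrm{Ker}(d_n)$, and the right homology module is the quotient functor $\mathcal{H}^R_n(C_\bullet)=\mathrm{Ker}(d_n)/\mathrm{Im}(d_{n+1}):\mathcal{A}^{op}\to\mathbf{Ab}$, i.e. $\mathcal{H}^R_n(C_\bullet)(X)=\mathrm{Ker}(d_n)(X)/\mathrm{Im}(d_{n+1})(X)$. $H_n(C_\bullet)$ denotes the usual homology object of $C_\bullet$ in the abelian category $\mathcal{A}$, and $\mathbf{Ab}$ is the category of abelian groups. *)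

theory Defs
  imports "HOL-Algebra.Coset"
begin

section \<open>Categories\<close>

record ('o, 'm) category =
  Obj :: "'o set"
  Arr :: "'m set"
  Dom :: "'m \<Rightarrow> 'o"
  Cod :: "'m \<Rightarrow> 'o"
  Id :: "'o \<Rightarrow> 'm"
  Comp :: "'m \<Rightarrow> 'm \<Rightarrow> 'm"  (infixl \<open>\<cdot>\<index>\<close> 70)

definition homset :: "('o, 'm, 'e) category_scheme \<Rightarrow> 'o \<Rightarrow> 'o \<Rightarrow> 'm set" where
  "homset C X Y = {f \<in> Arr C. Dom C f = X \<and> Cod C f = Y}"

locale category =
  fixes C :: "('o, 'm, 'e) category_scheme" (structure)
  assumes Dom_Obj: "f \<in> Arr C \<Longrightarrow> Dom C f \<in> Obj C"
    and Cod_Obj: "f \<in> Arr C \<Longrightarrow> Cod C f \<in> Obj C"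
    and Id_homset: "X \<in> Obj C \<Longrightarrow> Id C X \<in> homset C X X"
    and Comp_homset: "\<lbrakk>f \<in> homset C X Y; g \<in> homset C Y Z\<rbrakk> \<Longrightarrow> g \<cdot> f \<in> homset C X Z"
    and Comp_Id: "f \<in> homset C X Y \<Longrightarrow> f \<cdot> Id C X = f"
    and Id_Comp: "f \<in> homset C X Y \<Longrightarrow> Id C Y \<cdot> f = f"
    and Comp_assoc:
      "\<lbrakk>f \<in> homset C W X; g \<in> homset C X Y; h \<in> homset C Y Z\<rbrakk> \<Longrightarrow> (h \<cdot> g) \<cdot> f = h \<cdot> (g \<cdot> f)"

definition full_subcategory ::
    "('o, 'm, 'e) category_scheme \<Rightarrow> 'o set \<Rightarrow> ('o, 'm, 'e) category_scheme" where
  "full_subcategory C S =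
     C\<lparr>Obj := Obj C \<inter> S, Arr := {f \<in> Arr C. Dom C f \<in> S \<and> Cod C f \<in> S}\<rparr>"

definition is_mono :: "('o, 'm, 'e) category_scheme \<Rightarrow> 'm \<Rightarrow> bool" where
  "is_mono C m \<longleftrightarrow> m \<in> Arr C \<and>
     (\<forall>X \<in> Obj C. \<forall>f \<in> homset C X (Dom C m). \<forall>g \<in> homset C X (Dom C m).
        m \<cdot>\<^bsub>C\<^esub> f = m \<cdot>\<^bsub>C\<^esub> g \<longrightarrow> f = g)"

definition is_epi :: "('o, 'm, 'e) category_scheme \<Rightarrow> 'm \<Rightarrow> bool" where
  "is_epi C e \<longleftrightarrow> e \<in> Arr C \<and>
     (\<forall>X \<in> Obj C. \<forall>f \<in> homset C (Cod C e) X. \<forall>g \<in> homset C (Cod C e) X.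
        f \<cdot>\<^bsub>C\<^esub> e = g \<cdot>\<^bsub>C\<^esub> e \<longrightarrow> f = g)"

definition is_zero_object :: "('o, 'm, 'e) category_scheme \<Rightarrow> 'o \<Rightarrow> bool" where
  "is_zero_object C Z \<longleftrightarrow> Z \<in> Obj C \<and>
     (\<forall>X \<in> Obj C. (\<exists>!f. f \<in> homset C X Z) \<and> (\<exists>!f. f \<in> homset C Z X))"

definition projective :: "('o, 'm, 'e) category_scheme \<Rightarrow> 'o \<Rightarrow> bool" where
  "projective C P \<longleftrightarrow> P \<in> Obj C \<and>
     (\<forall>e. is_epi C e \<longrightarrow>
        (\<forall>f \<in> homset C P (Cod C e). \<exists>g \<in> homset C P (Dom C e). e \<cdot>\<^bsub>C\<^esub> g = f))"


section \<open>Abelian categories\<close>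

record ('o, 'm) preadditive = "('o, 'm) category" +
  Plus :: "'m \<Rightarrow> 'm \<Rightarrow> 'm"
  Zero :: "'o \<Rightarrow> 'o \<Rightarrow> 'm"

text \<open>Abelian groups are written with the multiplicative records of HOL-Algebra, so that its
  quotients \<open>G Mod H\<close> and isomorphisms \<open>iso G H\<close> apply: the product of this group is the sum of
  morphisms.\<close>

definition Hom_group :: "('o, 'm, 'e) preadditive_scheme \<Rightarrow> 'o \<Rightarrow> 'o \<Rightarrow> 'm monoid" where
  "Hom_group C X Y = \<lparr>carrier = homset C X Y, monoid.mult = Plus C, one = Zero C X Y\<rparr>"

locale preadditive_category = category C
  for C :: "('o, 'm, 'e) preadditive_scheme" (structure) +
  assumes Hom_comm_group: "\<lbrakk>X \<in> Obj C; Y \<in> Obj C\<rbrakk> \<Longrightarrow> comm_group (Hom_group C X Y)"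
    and Comp_Plus_left:
      "\<lbrakk>f \<in> homset C X Y; g \<in> homset C Y Z; g' \<in> homset C Y Z\<rbrakk>
        \<Longrightarrow> Plus C g g' \<cdot> f = Plus C (g \<cdot> f) (g' \<cdot> f)"
    and Comp_Plus_right:
      "\<lbrakk>f \<in> homset C X Y; f' \<in> homset C X Y; g \<in> homset C Y Z\<rbrakk>
        \<Longrightarrow> g \<cdot> Plus C f f' = Plus C (g \<cdot> f) (g \<cdot> f')"

definition is_biproduct ::
    "('o, 'm, 'e) preadditive_scheme \<Rightarrow> 'o \<Rightarrow> 'o \<Rightarrow> 'o \<Rightarrow> 'm \<Rightarrow> 'm \<Rightarrow> 'm \<Rightarrow> 'm \<Rightarrow> bool" where
  "is_biproduct C X Y B i j p q \<longleftrightarrow> B \<in> Obj C \<and>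
     i \<in> homset C X B \<and> j \<in> homset C Y B \<and> p \<in> homset C B X \<and> q \<in> homset C B Y \<and>
     p \<cdot>\<^bsub>C\<^esub> i = Id C X \<and> q \<cdot>\<^bsub>C\<^esub> j = Id C Y \<and>
     q \<cdot>\<^bsub>C\<^esub> i = Zero C X Y \<and> p \<cdot>\<^bsub>C\<^esub> j = Zero C Y X \<and>
     Plus C (i \<cdot>\<^bsub>C\<^esub> p) (j \<cdot>\<^bsub>C\<^esub> q) = Id C B"

definition is_kernel :: "('o, 'm, 'e) preadditive_scheme \<Rightarrow> 'm \<Rightarrow> 'm \<Rightarrow> bool" where
  "is_kernel C f k \<longleftrightarrow> f \<in> Arr C \<and> k \<in> Arr C \<and> Cod C k = Dom C f \<and>
     f \<cdot>\<^bsub>C\<^esub> k = Zero C (Dom C k) (Cod C f) \<and>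
     (\<forall>X \<in> Obj C. \<forall>g \<in> homset C X (Dom C f). f \<cdot>\<^bsub>C\<^esub> g = Zero C X (Cod C f) \<longrightarrow>
        (\<exists>!h. h \<in> homset C X (Dom C k) \<and> k \<cdot>\<^bsub>C\<^esub> h = g))"

definition is_cokernel :: "('o, 'm, 'e) preadditive_scheme \<Rightarrow> 'm \<Rightarrow> 'm \<Rightarrow> bool" where
  "is_cokernel C f q \<longleftrightarrow> f \<in> Arr C \<and> q \<in> Arr C \<and> Dom C q = Cod C f \<and>
     q \<cdot>\<^bsub>C\<^esub> f = Zero C (Dom C f) (Cod C q) \<and>
     (\<forall>X \<in> Obj C. \<forall>g \<in> homset C (Cod C f) X. g \<cdot>\<^bsub>C\<^esub> f = Zero C (Dom C f) X \<longrightarrow>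
        (\<exists>!h. h \<in> homset C (Cod C q) X \<and> h \<cdot>\<^bsub>C\<^esub> q = g))"

locale abelian_category = preadditive_category C
  for C :: "('o, 'm, 'e) preadditive_scheme" (structure) +
  assumes ex_zero_object: "\<exists>Z. is_zero_object C Z"
    and ex_biproduct: "\<lbrakk>X \<in> Obj C; Y \<in> Obj C\<rbrakk> \<Longrightarrow> \<exists>B i j p q. is_biproduct C X Y B i j p q"
    and ex_kernel: "f \<in> Arr C \<Longrightarrow> \<exists>k. is_kernel C f k"
    and ex_cokernel: "f \<in> Arr C \<Longrightarrow> \<exists>q. is_cokernel C f q"
    and mono_is_kernel: "is_mono C m \<Longrightarrow> \<exists>f. is_kernel C f m"
    and epi_is_cokernel: "is_epi C e \<Longrightarrow> \<exists>f. is_cokernel C f e"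


section \<open>Complexes and their homology objects\<close>

definition chain_complex ::
    "('o, 'm, 'e) preadditive_scheme \<Rightarrow> (int \<Rightarrow> 'o) \<Rightarrow> (int \<Rightarrow> 'm) \<Rightarrow> bool" where
  "chain_complex C Ch d \<longleftrightarrow>
     (\<forall>n. Ch n \<in> Obj C) \<and> (\<forall>n. d n \<in> homset C (Ch n) (Ch (n - 1))) \<and>
     (\<forall>n. d n \<cdot>\<^bsub>C\<^esub> d (n + 1) = Zero C (Ch (n + 1)) (Ch (n - 1)))"

text \<open>The homology of \<open>A -f\<rightarrow> B -g\<rightarrow> D\<close> is the quotient of the kernel \<open>k\<close> of \<open>g\<close> by the image \<open>m\<close>
  of \<open>f\<close> (the kernel of the cokernel of \<open>f\<close>), that is, the cokernel of the morphism \<open>u\<close> through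
  which \<open>m\<close> factors over \<open>k\<close>. Being determined up to isomorphism only, it is a relation.\<close>

definition is_homology_object ::
    "('o, 'm, 'e) preadditive_scheme \<Rightarrow> (int \<Rightarrow> 'm) \<Rightarrow> int \<Rightarrow> 'o \<Rightarrow> bool" where
  "is_homology_object C d n H \<longleftrightarrow>
     (\<exists>k c m u p. is_kernel C (d n) k \<and> is_cokernel C (d (n + 1)) c \<and> is_kernel C c m \<and>
        u \<in> homset C (Dom C m) (Dom C k) \<and> k \<cdot>\<^bsub>C\<^esub> u = m \<and>
        is_cokernel C u p \<and> Cod C p = H)"


section \<open>Contravariant functors to abelian groups\<close>

text \<open>For \<open>f : X \<rightarrow> Y\<close> the map \<open>FMor F f\<close> goes from \<open>FObj F Y\<close> to \<open>FObj F X\<close>; only its values on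
  the carrier of \<open>FObj F Y\<close> matter. Restricting a functor to a subcategory leaves these data
  unchanged.\<close>

record ('o, 'm, 'x) presheaf =
  FObj :: "'o \<Rightarrow> 'x monoid"
  FMor :: "'m \<Rightarrow> 'x \<Rightarrow> 'x"

locale Ab_presheaf = category C
  for C :: "('o, 'm, 'e) category_scheme" (structure) and F :: "('o, 'm, 'x) presheaf" +
  assumes FObj_comm_group: "X \<in> Obj C \<Longrightarrow> comm_group (FObj F X)"
    and FMor_hom: "f \<in> homset C X Y \<Longrightarrow> FMor F f \<in> hom (FObj F Y) (FObj F X)"
    and FMor_Id: "\<lbrakk>X \<in> Obj C; x \<in> carrier (FObj F X)\<rbrakk> \<Longrightarrow> FMor F (Id C X) x = x"
    and FMor_Comp:
      "\<lbrakk>f \<in> homset C X Y; g \<in> homset C Y Z; z \<in> carrier (FObj F Z)\<rbrakk>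
        \<Longrightarrow> FMor F (g \<cdot> f) z = FMor F f (FMor F g z)"

locale Ab_presheaf_iso = F: Ab_presheaf C F + G: Ab_presheaf C G
  for C :: "('o, 'm, 'e) category_scheme" (structure)
    and F :: "('o, 'm, 'x) presheaf" and G :: "('o, 'm, 'y) presheaf"
    and \<eta> :: "'o \<Rightarrow> 'x \<Rightarrow> 'y" +
  assumes component_iso: "X \<in> Obj C \<Longrightarrow> \<eta> X \<in> iso (FObj F X) (FObj G X)"
    and natural:
      "\<lbrakk>f \<in> homset C X Y; y \<in> carrier (FObj F Y)\<rbrakk>
        \<Longrightarrow> \<eta> X (FMor F f y) = FMor G f (\<eta> Y y)"

definition Ab_presheaf_isomorphic ::
    "('o, 'm, 'e) category_scheme \<Rightarrow> ('o, 'm, 'x) presheaf \<Rightarrow> ('o, 'm, 'y) presheaf \<Rightarrow> bool" where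
  "Ab_presheaf_isomorphic C F G \<longleftrightarrow> (\<exists>\<eta>. Ab_presheaf_iso C F G \<eta>)"

definition Hom_presheaf ::
    "('o, 'm, 'e) preadditive_scheme \<Rightarrow> 'o \<Rightarrow> ('o, 'm, 'm) presheaf" where
  "Hom_presheaf C H = \<lparr>FObj = (\<lambda>X. Hom_group C X H), FMor = (\<lambda>f \<phi>. \<phi> \<cdot>\<^bsub>C\<^esub> f)\<rparr>"


section \<open>The right homology module\<close>

definition Ker_ideal :: "('o, 'm, 'e) preadditive_scheme \<Rightarrow> 'm \<Rightarrow> 'o \<Rightarrow> 'm set" where
  "Ker_ideal C f X = {\<phi> \<in> homset C X (Dom C f). f \<cdot>\<^bsub>C\<^esub> \<phi> = Zero C X (Cod C f)}"

definition Coker_ideal :: "('o, 'm, 'e) preadditive_scheme \<Rightarrow> 'm \<Rightarrow> 'o \<Rightarrow> 'm set" where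
  "Coker_ideal C f X = {\<psi> \<in> homset C (Cod C f) X. \<psi> \<cdot>\<^bsub>C\<^esub> f = Zero C (Dom C f) X}"

definition Im_ideal :: "('o, 'm, 'e) preadditive_scheme \<Rightarrow> 'm \<Rightarrow> 'o \<Rightarrow> 'm set" where
  "Im_ideal C f X = {\<phi> \<in> homset C X (Cod C f).
     \<forall>Y \<in> Obj C. \<forall>\<psi> \<in> Coker_ideal C f Y. \<psi> \<cdot>\<^bsub>C\<^esub> \<phi> = Zero C X Y}"

text \<open>A class in \<open>Ker(d\<^sub>n)(Y) / Im(d\<^sub>n\<^sub>+\<^sub>1)(Y)\<close> is a coset \<open>K\<close>. Precomposing its members
  with \<open>f : X \<rightarrow> Y\<close> yields in general only part of a coset of \<open>Im(d\<^sub>n\<^sub>+\<^sub>1)(X)\<close>; adding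
  \<open>Im(d\<^sub>n\<^sub>+\<^sub>1)(X)\<close> completes it. See \<open>right_homology_FMor_coset\<close> below.\<close>

definition right_homology ::
    "('o, 'm, 'e) preadditive_scheme \<Rightarrow> (int \<Rightarrow> 'm) \<Rightarrow> int \<Rightarrow> ('o, 'm, 'm set) presheaf" where
  "right_homology C d n =
     \<lparr>FObj = (\<lambda>X. (Hom_group C X (Dom C (d n)))\<lparr>carrier := Ker_ideal C (d n) X\<rparr>
                    Mod Im_ideal C (d (n + 1)) X),
      FMor = (\<lambda>f K. Im_ideal C (d (n + 1)) (Dom C f)
                    <#>\<^bsub>Hom_group C (Dom C f) (Dom C (d n))\<^esub> ((\<lambda>\<phi>. \<phi> \<cdot>\<^bsub>C\<^esub> f) ` K))\<rparr>"


section \<open>Consistency of the definitions\<close>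

lemma homsetD:
  assumes "f \<in> homset C X Y"
  shows "f \<in> Arr C" "Dom C f = X" "Cod C f = Y"
  using assms by (auto simp: homset_def)

lemma (in category) homset_Obj:
  assumes "f \<in> homset C X Y"
  shows "X \<in> Obj C" "Y \<in> Obj C"
  using assms Dom_Obj Cod_Obj by (auto simp: homset_def)

context preadditive_category
begin

lemma Hom_group_simps [simp]:
  "carrier (Hom_group C X Y) = homset C X Y"
  "mult (Hom_group C X Y) = Plus C"
  "one (Hom_group C X Y) = Zero C X Y"
  by (auto simp: Hom_group_def)

lemma Zero_homset: "X \<in> Obj C \<Longrightarrow> Y \<in> Obj C \<Longrightarrow> Zero C X Y \<in> homset C X Y"
  using comm_group.axioms(2)[OF Hom_comm_group, THEN group.is_monoid, THEN monoid.one_closed]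
  by simp

lemma precomp_hom:
  assumes "f \<in> homset C X Y" "Z \<in> Obj C"
  shows "group_hom (Hom_group C Y Z) (Hom_group C X Z) (\<lambda>\<phi>. \<phi> \<cdot> f)"
proof -
  have "X \<in> Obj C" "Y \<in> Obj C" using assms homset_Obj by auto
  then show ?thesis
    using assms Hom_comm_group
    by (auto simp: group_hom_def group_hom_axioms_def comm_group_def hom_def
        intro: Comp_homset Comp_Plus_left)
qed

lemma postcomp_hom:
  assumes "g \<in> homset C Y Z" "X \<in> Obj C"
  shows "group_hom (Hom_group C X Y) (Hom_group C X Z) (\<lambda>\<phi>. g \<cdot> \<phi>)"
proof -
  have "Z \<in> Obj C" "Y \<in> Obj C" using assms homset_Obj by auto
  then show ?thesis
    using assms Hom_comm_group
    by (auto simp: group_hom_def group_hom_axioms_def comm_group_def hom_def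
        intro: Comp_homset Comp_Plus_right)
qed

lemma Zero_Comp: "f \<in> homset C X Y \<Longrightarrow> Z \<in> Obj C \<Longrightarrow> Zero C Y Z \<cdot> f = Zero C X Z"
  using group_hom.hom_one[OF precomp_hom] by simp

lemma Comp_Zero: "g \<in> homset C Y Z \<Longrightarrow> X \<in> Obj C \<Longrightarrow> g \<cdot> Zero C X Y = Zero C X Z"
  using group_hom.hom_one[OF postcomp_hom] by simp

lemma Ker_ideal_subgroup:
  assumes "f \<in> Arr C" "X \<in> Obj C"
  shows "subgroup (Ker_ideal C f X) (Hom_group C X (Dom C f))"
proof -
  have f: "f \<in> homset C (Dom C f) (Cod C f)" using assms by (simp add: homset_def)
  interpret group_hom "Hom_group C X (Dom C f)" "Hom_group C X (Cod C f)" "\<lambda>\<phi>. f \<cdot> \<phi>"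
    by (rule postcomp_hom[OF f assms(2)])
  have "Ker_ideal C f X = kernel (Hom_group C X (Dom C f)) (Hom_group C X (Cod C f)) (\<lambda>\<phi>. f \<cdot> \<phi>)"
    by (auto simp: Ker_ideal_def kernel_def)
  then show ?thesis using subgroup_kernel by simp
qed

lemma Im_ideal_subgroup:
  assumes "f \<in> Arr C" "X \<in> Obj C"
  shows "subgroup (Im_ideal C f X) (Hom_group C X (Cod C f))"
proof -
  let ?G = "Hom_group C X (Cod C f)"
  let ?N = "\<lambda>(Y, \<psi>). {\<phi> \<in> homset C X (Cod C f). \<psi> \<cdot> \<phi> = Zero C X Y}"
  let ?I = "{(Y, \<psi>). Y \<in> Obj C \<and> \<psi> \<in> Coker_ideal C f Y}"
  have G: "group ?G"
    using Hom_comm_group[OF assms(2) Cod_Obj[OF assms(1)]] by (simp add: comm_group_def)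
  have N: "subgroup (?N i) ?G" if "i \<in> ?I" for i
  proof -
    obtain Y \<psi> where i: "i = (Y, \<psi>)" "Y \<in> Obj C" "\<psi> \<in> homset C (Cod C f) Y"
      using \<open>i \<in> ?I\<close> by (auto simp: Coker_ideal_def)
    interpret group_hom ?G "Hom_group C X Y" "\<lambda>\<phi>. \<psi> \<cdot> \<phi>"
      by (rule postcomp_hom[OF i(3) assms(2)])
    show ?thesis using subgroup_kernel i by (simp add: kernel_def)
  qed
  have "Im_ideal C f X = \<Inter> (insert (carrier ?G) (?N ` ?I))"
    by (auto simp: Im_ideal_def)
  also have "subgroup \<dots> ?G"
    by (rule group.subgroups_Inter[OF G]) (use N group.subgroup_self[OF G] in auto)
  finally show ?thesis .
qed

lemma Im_ideal_subset_Ker_ideal: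
  assumes "chain_complex C Ch d" "X \<in> Obj C"
  shows "Im_ideal C (d (n + 1)) X \<subseteq> Ker_ideal C (d n) X"
proof -
  have d: "d n \<in> homset C (Ch n) (Ch (n - 1))" "d (n + 1) \<in> homset C (Ch (n + 1)) (Ch n)"
    "d n \<cdot> d (n + 1) = Zero C (Ch (n + 1)) (Ch (n - 1))" "Ch (n - 1) \<in> Obj C"
    using assms(1) spec[of "\<lambda>n. d n \<in> homset C (Ch n) (Ch (n - 1))" "n + 1"]
    by (auto simp: chain_complex_def)
  then have "d n \<in> Coker_ideal C (d (n + 1)) (Ch (n - 1))"
    by (auto simp: Coker_ideal_def homset_def)
  then show ?thesis using d by (auto simp: Im_ideal_def Ker_ideal_def homset_def)
qed

lemma Ker_ideal_precomp:
  assumes "g \<in> Arr C" "f \<in> homset C X Y" "\<phi> \<in> Ker_ideal C g Y"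
  shows "\<phi> \<cdot> f \<in> Ker_ideal C g X"
proof -
  have g: "g \<in> homset C (Dom C g) (Cod C g)" using assms by (simp add: homset_def)
  have "\<phi> \<in> homset C Y (Dom C g)" using assms(3) by (simp add: Ker_ideal_def)
  then have "g \<cdot> (\<phi> \<cdot> f) = (g \<cdot> \<phi>) \<cdot> f" using Comp_assoc[OF assms(2) _ g] by metis
  then show ?thesis
    using assms Comp_homset[OF assms(2)] Zero_Comp[OF assms(2) Cod_Obj[OF assms(1)]]
    by (simp add: Ker_ideal_def)
qed

lemma Im_ideal_precomp:
  assumes "f \<in> homset C X Y" "\<phi> \<in> Im_ideal C g Y"
  shows "\<phi> \<cdot> f \<in> Im_ideal C g X"
proof -
  have \<phi>: "\<phi> \<in> homset C Y (Cod C g)" using assms by (simp add: Im_ideal_def)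
  have "\<psi> \<cdot> (\<phi> \<cdot> f) = Zero C X Z" if "Z \<in> Obj C" "\<psi> \<in> Coker_ideal C g Z" for Z \<psi>
    using Comp_assoc[OF assms(1) \<phi>, of \<psi> Z] that assms Zero_Comp[OF assms(1) that(1)]
    by (simp add: Im_ideal_def Coker_ideal_def)
  then show ?thesis using Comp_homset[OF assms(1) \<phi>] by (simp add: Im_ideal_def)
qed

lemma right_homology_FMor_coset:
  assumes "chain_complex C Ch d" "f \<in> homset C X Y" "\<phi> \<in> homset C Y (Ch n)"
  shows "FMor (right_homology C d n) f (Im_ideal C (d (n + 1)) Y #>\<^bsub>Hom_group C Y (Ch n)\<^esub> \<phi>)
    = Im_ideal C (d (n + 1)) X #>\<^bsub>Hom_group C X (Ch n)\<^esub> (\<phi> \<cdot> f)"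
proof -
  have XY: "X \<in> Obj C" "Y \<in> Obj C" using assms(2) homset_Obj by auto
  have d: "d n \<in> homset C (Ch n) (Ch (n - 1))" "d (n + 1) \<in> homset C (Ch (n + 1)) (Ch n)"
    and Ch: "Ch n \<in> Obj C"
    using assms(1) spec[of "\<lambda>n. d n \<in> homset C (Ch n) (Ch (n - 1))" "n + 1"]
    by (auto simp: chain_complex_def)
  let ?G = "Hom_group C X (Ch n)" and ?I = "Im_ideal C (d (n + 1))"
  interpret comm_group ?G by (rule Hom_comm_group[OF XY(1) Ch])
  have I: "subgroup (?I Z) (Hom_group C Z (Ch n))" if "Z \<in> Obj C" for Z
    using Im_ideal_subgroup[OF homsetD(1)[OF d(2)] that] homsetD(3)[OF d(2)] by simp
  have sub: "?I Z \<subseteq> homset C Z (Ch n)" if "Z \<in> Obj C" for Z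
    using subgroup.subset[OF I[OF that]] by simp
  have \<phi>f: "\<phi> \<cdot> f \<in> homset C X (Ch n)" by (rule Comp_homset[OF assms(2,3)])
  have img: "(\<lambda>\<phi>. \<phi> \<cdot> f) ` (?I Y #>\<^bsub>Hom_group C Y (Ch n)\<^esub> \<phi>) = ((\<lambda>\<phi>. \<phi> \<cdot> f) ` ?I Y) #>\<^bsub>?G\<^esub> (\<phi> \<cdot> f)"
    using sub[OF XY(2)] by (auto simp: r_coset_def image_iff Comp_Plus_left[OF assms(2) _ assms(3)] subset_iff)
  have J: "(\<lambda>\<phi>. \<phi> \<cdot> f) ` ?I Y \<subseteq> ?I X" using Im_ideal_precomp[OF assms(2)] by auto
  have "?I X <#>\<^bsub>?G\<^esub> ((\<lambda>\<phi>. \<phi> \<cdot> f) ` ?I Y) = ?I X"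
  proof
    show "?I X <#>\<^bsub>?G\<^esub> ((\<lambda>\<phi>. \<phi> \<cdot> f) ` ?I Y) \<subseteq> ?I X"
      using J subgroup.m_closed[OF I[OF XY(1)]] by (auto simp: set_mult_def)
    have "Zero C X (Ch n) \<in> (\<lambda>\<phi>. \<phi> \<cdot> f) ` ?I Y"
      using subgroup.one_closed[OF I[OF XY(2)]] Zero_Comp[OF assms(2) Ch] by (force simp: image_iff)
    then show "?I X \<subseteq> ?I X <#>\<^bsub>?G\<^esub> ((\<lambda>\<phi>. \<phi> \<cdot> f) ` ?I Y)"
      using sub[OF XY(1)] r_one by (force simp: set_mult_def)
  qed
  then have "?I X <#>\<^bsub>?G\<^esub> (((\<lambda>\<phi>. \<phi> \<cdot> f) ` ?I Y) #>\<^bsub>?G\<^esub> (\<phi> \<cdot> f)) = ?I X #>\<^bsub>?G\<^esub> (\<phi> \<cdot> f)"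
    using setmult_rcos_assoc[of "?I X" "(\<lambda>\<phi>. \<phi> \<cdot> f) ` ?I Y" "\<phi> \<cdot> f"] J sub[OF XY(1)] \<phi>f by simp
  then show ?thesis
    using homsetD[OF assms(2)] homsetD[OF d(1)] img by (simp add: right_homology_def)
qed

lemma right_homology_presheaf:
  assumes "chain_complex C Ch d"
  shows "Ab_presheaf C (right_homology C d n)"
proof -
  let ?F = "right_homology C d n" and ?I = "Im_ideal C (d (n + 1))" and ?K = "Ker_ideal C (d n)"
  let ?G = "\<lambda>X. Hom_group C X (Ch n)"
  let ?S = "\<lambda>X. (?G X)\<lparr>carrier := ?K X\<rparr>"
  have d: "d n \<in> homset C (Ch n) (Ch (n - 1))" "d (n + 1) \<in> homset C (Ch (n + 1)) (Ch n)"
    and Ch: "Ch n \<in> Obj C"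
    using assms(1) spec[of "\<lambda>n. d n \<in> homset C (Ch n) (Ch (n - 1))" "n + 1"]
    by (auto simp: chain_complex_def)
  note D = homsetD[OF d(1)] homsetD[OF d(2)]
  have FObj: "FObj ?F X = ?S X Mod ?I X" for X
    using D by (simp add: right_homology_def)
  have G: "comm_group (?G X)" if "X \<in> Obj C" for X using Hom_comm_group that Ch by blast
  have K: "subgroup (?K X) (?G X)" if "X \<in> Obj C" for X
    using Ker_ideal_subgroup[OF D(1) that] D by simp
  have S: "comm_group (?S X)" if "X \<in> Obj C" for X
  proof -
    interpret comm_group "?G X" by (rule G[OF that])
    have "group (?S X)" by (rule subgroup.subgroup_is_group[OF K[OF that] is_group])
    then show ?thesis
      by (rule group.group_comm_groupI) (use m_comm subgroup.subset[OF K[OF that]] in auto)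
  qed
  have I: "subgroup (?I X) (?S X)" if "X \<in> Obj C" for X
    using group.subgroup_incl[OF comm_group.axioms(2)[OF G[OF that]] _ K[OF that]]
      Im_ideal_subgroup[OF D(4) that] Im_ideal_subset_Ker_ideal[OF assms that] D by simp
  have N: "normal (?I X) (?S X)" if "X \<in> Obj C" for X
    using comm_group.normal_iff_subgroup[OF S] I that by blast
  have comm: "comm_group (FObj ?F X)" if "X \<in> Obj C" for X
    using comm_group.abelian_FactGroup[OF S I] that FObj by simp
  have car: "carrier (FObj ?F X) = (\<lambda>\<phi>. ?I X #>\<^bsub>?G X\<^esub> \<phi>) ` ?K X" for X
    by (simp add: FObj carrier_FactGroup r_coset_def)
  have Ksub: "\<phi> \<in> homset C X (Ch n)" if "\<phi> \<in> ?K X" for X \<phi>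
    using that D by (simp add: Ker_ideal_def)
  have FM: "FMor ?F f (?I Y #>\<^bsub>?G Y\<^esub> \<phi>) = ?I X #>\<^bsub>?G X\<^esub> (\<phi> \<cdot> f)"
    if "f \<in> homset C X Y" "\<phi> \<in> ?K Y" for f X Y \<phi>
    using right_homology_FMor_coset[OF assms that(1)] Ksub that(2) by blast
  have mul: "mult (FObj ?F X) (?I X #>\<^bsub>?G X\<^esub> \<phi>) (?I X #>\<^bsub>?G X\<^esub> \<psi>) = ?I X #>\<^bsub>?G X\<^esub> Plus C \<phi> \<psi>"
    if "X \<in> Obj C" "\<phi> \<in> ?K X" "\<psi> \<in> ?K X" for X \<phi> \<psi>
    using normal.rcos_sum[OF N[OF that(1)], of \<phi> \<psi>] that
    by (simp add: FObj r_coset_def set_mult_def)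
  show ?thesis
  proof (intro Ab_presheaf.intro category_axioms Ab_presheaf_axioms.intro)
    fix f X Y assume f: "f \<in> homset C X Y"
    note XY = homset_Obj[OF f]
    have pre: "\<phi> \<cdot> f \<in> ?K X" if "\<phi> \<in> ?K Y" for \<phi> by (rule Ker_ideal_precomp[OF D(1) f that])
    have Kplus: "Plus C \<phi> \<psi> \<in> ?K Y" if "\<phi> \<in> ?K Y" "\<psi> \<in> ?K Y" for \<phi> \<psi>
      using subgroup.m_closed[OF K[OF XY(2)] that] by simp
    show "FMor ?F f \<in> hom (FObj ?F Y) (FObj ?F X)"
    proof (rule homI)
      fix x assume "x \<in> carrier (FObj ?F Y)"
      then show "FMor ?F f x \<in> carrier (FObj ?F X)" using FM[OF f] pre by (auto simp: car)
    next
      fix x y assume "x \<in> carrier (FObj ?F Y)" "y \<in> carrier (FObj ?F Y)"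
      then obtain \<phi> \<psi> where *: "\<phi> \<in> ?K Y" "\<psi> \<in> ?K Y"
        and xy: "x = ?I Y #>\<^bsub>?G Y\<^esub> \<phi>" "y = ?I Y #>\<^bsub>?G Y\<^esub> \<psi>" by (auto simp: car)
      show "FMor ?F f (x \<otimes>\<^bsub>FObj ?F Y\<^esub> y) = FMor ?F f x \<otimes>\<^bsub>FObj ?F X\<^esub> FMor ?F f y"
        unfolding xy mul[OF XY(2) *] FM[OF f *(1)] FM[OF f *(2)] FM[OF f Kplus[OF *]]
          mul[OF XY(1) pre[OF *(1)] pre[OF *(2)]]
          Comp_Plus_left[OF f Ksub[OF *(1)] Ksub[OF *(2)]] ..
    qed
  next
    fix X x assume X: "X \<in> Obj C" and "x \<in> carrier (FObj ?F X)"
    then obtain \<phi> where "\<phi> \<in> ?K X" "x = ?I X #>\<^bsub>?G X\<^esub> \<phi>" by (auto simp: car)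
    then show "FMor ?F (Id C X) x = x"
      using FM[OF Id_homset[OF X]] Comp_Id[OF Ksub] by simp
  next
    fix f X Y g Z z assume f: "f \<in> homset C X Y" and g: "g \<in> homset C Y Z"
      and "z \<in> carrier (FObj ?F Z)"
    then obtain \<phi> where \<phi>: "\<phi> \<in> ?K Z" "z = ?I Z #>\<^bsub>?G Z\<^esub> \<phi>" by (auto simp: car)
    show "FMor ?F (g \<cdot> f) z = FMor ?F f (FMor ?F g z)"
      using FM[OF Comp_homset[OF f g] \<phi>(1)] FM[OF g \<phi>(1)]
        FM[OF f Ker_ideal_precomp[OF D(1) g \<phi>(1)]] Comp_assoc[OF f g Ksub[OF \<phi>(1)]] \<phi>(2) by simp
  qed (rule comm)
qed

end

text \<open>Homology objects exist, so quantifying over all of them is not vacuous.\<close>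

lemma (in abelian_category) ex_homology_object:
  assumes "chain_complex C Ch d"
  shows "\<exists>H. is_homology_object C d n H"
proof -
  have d: "d n \<in> homset C (Ch n) (Ch (n - 1))" "d (n + 1) \<in> homset C (Ch (n + 1)) (Ch n)"
    "d n \<cdot> d (n + 1) = Zero C (Ch (n + 1)) (Ch (n - 1))" "Ch (n - 1) \<in> Obj C"
    using assms(1) spec[of "\<lambda>n. d n \<in> homset C (Ch n) (Ch (n - 1))" "n + 1"]
    by (auto simp: chain_complex_def)
  note D = homsetD[OF d(1)] homsetD[OF d(2)]
  obtain k where k: "is_kernel C (d n) k" using ex_kernel D by blast
  obtain c where c: "is_cokernel C (d (n + 1)) c" using ex_cokernel D by blast
  then obtain m where m: "is_kernel C c m" using ex_kernel unfolding is_cokernel_def by blast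
  have cA: "c \<in> homset C (Ch n) (Cod C c)" using c D by (auto simp: is_cokernel_def homset_def)
  have mA: "m \<in> homset C (Dom C m) (Ch n)"
    using m cA by (auto simp: is_kernel_def homset_def)
  obtain h where h: "h \<in> homset C (Cod C c) (Ch (n - 1))" "h \<cdot> c = d n"
    using c d D unfolding is_cokernel_def by metis
  have "d n \<cdot> m = h \<cdot> (c \<cdot> m)" using Comp_assoc[OF mA cA h(1)] h(2) by simp
  also have "\<dots> = Zero C (Dom C m) (Ch (n - 1))"
    using m Comp_Zero[OF h(1)] homset_Obj[OF mA] by (simp add: is_kernel_def)
  finally obtain u where u: "u \<in> homset C (Dom C m) (Dom C k)" "k \<cdot> u = m"
    using k mA D homset_Obj(1)[OF mA] unfolding is_kernel_def by metis
  obtain p where "is_cokernel C u p" using ex_cokernel u homsetD by metis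
  then show ?thesis using k c m u unfolding is_homology_object_def by blast
qed

end

theory Submission
  imports Defs
begin

text \<open>Write \<open>k : K \<rightarrow> C\<^sub>n\<close> for the kernel of \<open>d\<^sub>n\<close> and \<open>u : I \<rightarrow> K\<close> for the inclusion of the image
  of \<open>d\<^sub>n\<^sub>+\<^sub>1\<close>, so that \<open>p : K \<rightarrow> H\<close> is the cokernel of \<open>u\<close>. Every element of \<open>Ker(d\<^sub>n)(X)\<close> is
  \<open>k \<cdot> h\<close> for a unique \<open>h : X \<rightarrow> K\<close>, and sending it to \<open>p \<cdot> h\<close> is a homomorphism to \<open>Hom(X, H)\<close>,
  natural in \<open>X\<close>. As \<open>u\<close> is monic, it is the kernel of \<open>p\<close>; hence \<open>p \<cdot> h = 0\<close> iff \<open>k \<cdot> h\<close> factors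
  through the image of \<open>d\<^sub>n\<^sub>+\<^sub>1\<close>, i.e. lies in \<open>Im(d\<^sub>n\<^sub>+\<^sub>1)(X)\<close>. As \<open>p\<close> is epic, the homomorphism
  is surjective for projective \<open>X\<close>, and the first isomorphism theorem applies.\<close>

section \<open>Restriction of presheaves to a full subcategory\<close>

lemma homset_full_subcategory:
  "homset (full_subcategory C S) X Y = {f \<in> homset C X Y. X \<in> S \<and> Y \<in> S}"
  by (auto simp: homset_def full_subcategory_def)

lemma full_subcategory_simps [simp]:
  "Obj (full_subcategory C S) = Obj C \<inter> S"
  "Id (full_subcategory C S) = Id C"
  "Comp (full_subcategory C S) = Comp C"
  by (simp_all add: full_subcategory_def)

lemma (in category) category_full_subcategory: "category (full_subcategory C S)"
proof
  fix f assume "f \<in> Arr (full_subcategory C S)"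
  then show "Dom (full_subcategory C S) f \<in> Obj (full_subcategory C S)"
    and "Cod (full_subcategory C S) f \<in> Obj (full_subcategory C S)"
    using Dom_Obj Cod_Obj by (auto simp: full_subcategory_def)
qed (auto simp: homset_full_subcategory Id_homset Comp_Id Id_Comp Comp_homset Comp_assoc)

lemma (in Ab_presheaf) Ab_presheaf_full_subcategory:
  "Ab_presheaf (full_subcategory C S) F"
  by (intro Ab_presheaf.intro category_full_subcategory Ab_presheaf_axioms.intro)
    (auto simp: homset_full_subcategory FObj_comm_group FMor_hom FMor_Id FMor_Comp)

section \<open>Hom presheaves, kernels and cokernels in preadditive categories\<close>

context preadditive_category
begin

lemma Hom_presheaf_presheaf:
  assumes "H \<in> Obj C"
  shows "Ab_presheaf C (Hom_presheaf C H)"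
proof (intro Ab_presheaf.intro category_axioms Ab_presheaf_axioms.intro)
  fix f X Y assume "f \<in> homset C X Y"
  then show "FMor (Hom_presheaf C H) f
      \<in> hom (FObj (Hom_presheaf C H) Y) (FObj (Hom_presheaf C H) X)"
    using group_hom.homh[OF precomp_hom[OF _ assms]] by (simp add: Hom_presheaf_def)
qed (auto simp: Hom_presheaf_def assms Hom_comm_group Comp_Id Comp_assoc)

lemma is_kernel_homset:
  assumes "is_kernel C f k"
  shows "k \<in> homset C (Dom C k) (Dom C f)" "f \<in> homset C (Dom C f) (Cod C f)"
  using assms by (auto simp: is_kernel_def homset_def)

lemma is_cokernel_homset:
  assumes "is_cokernel C f q"
  shows "q \<in> homset C (Cod C f) (Cod C q)" "f \<in> homset C (Dom C f) (Cod C f)"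
  using assms by (auto simp: is_cokernel_def homset_def)

lemma kernel_Comp:
  assumes "is_kernel C f k" "h \<in> homset C X (Dom C k)"
  shows "k \<cdot> h \<in> Ker_ideal C f X"
proof -
  note k = is_kernel_homset[OF assms(1)]
  have "f \<cdot> (k \<cdot> h) = f \<cdot> k \<cdot> h" using Comp_assoc[OF assms(2) k] by simp
  also have "\<dots> = Zero C X (Cod C f)"
    using assms Zero_Comp[OF assms(2)] homset_Obj[OF k(2)] by (simp add: is_kernel_def)
  finally show ?thesis using Comp_homset[OF assms(2) k(1)] by (simp add: Ker_ideal_def)
qed

text \<open>Together with \<open>kernel_Comp\<close> this identifies the kernel ideal of
  \<open>f\<close> at \<open>X\<close> with the morphisms from \<open>X\<close> to
  \<open>Dom C k\<close>, which links the ideal to the kernel object.\<close>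

lemma kernel_ex1:
  assumes "is_kernel C f k" "\<phi> \<in> Ker_ideal C f X"
  shows "\<exists>!h. h \<in> homset C X (Dom C k) \<and> k \<cdot> h = \<phi>"
proof -
  have \<phi>: "\<phi> \<in> homset C X (Dom C f)" "f \<cdot> \<phi> = Zero C X (Cod C f)"
    using assms(2) by (auto simp: Ker_ideal_def)
  show ?thesis using assms(1) \<phi> homset_Obj(1)[OF \<phi>(1)] unfolding is_kernel_def by blast
qed

lemma is_kernel_mono:
  assumes "is_kernel C f k"
  shows "is_mono C k"
  unfolding is_mono_def
proof (intro conjI ballI impI)
  show "k \<in> Arr C" using assms by (simp add: is_kernel_def)
  fix X g h assume *: "g \<in> homset C X (Dom C k)" "h \<in> homset C X (Dom C k)" "k \<cdot> g = k \<cdot> h"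
  then show "g = h" using kernel_ex1[OF assms kernel_Comp[OF assms *(1)]] by auto
qed

text \<open>If \<open>g\<close> and \<open>h\<close> agree after composition with \<open>q\<close>,
  both factor the same morphism through \<open>q\<close>. That morphism kills \<open>f\<close>, so
  its factorization is unique.\<close>

lemma is_cokernel_epi:
  assumes "is_cokernel C f q"
  shows "is_epi C q"
  unfolding is_epi_def
proof (intro conjI ballI impI)
  note q = is_cokernel_homset[OF assms]
  show "q \<in> Arr C" using homsetD(1)[OF q(1)] .
  fix X g h assume X: "X \<in> Obj C" and gh: "g \<in> homset C (Cod C q) X" "h \<in> homset C (Cod C q) X"
    and eq: "g \<cdot> q = h \<cdot> q"
  have "g \<cdot> q \<cdot> f = g \<cdot> (q \<cdot> f)" using Comp_assoc[OF q(2,1) gh(1)] .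
  also have "\<dots> = Zero C (Dom C f) X"
    using assms Comp_Zero[OF gh(1)] homset_Obj[OF q(2)] by (simp add: is_cokernel_def)
  finally have "\<exists>!h. h \<in> homset C (Cod C q) X \<and> h \<cdot> q = g \<cdot> q"
    using assms X Comp_homset[OF q(1) gh(1)] unfolding is_cokernel_def by blast
  then show "g = h" using gh eq by metis
qed

text \<open>This serves to show that the inclusion \<open>u\<close> of the image into the kernel is
  monic, given that \<open>k \<cdot> u\<close> is the image inclusion.\<close>

lemma is_mono_Comp_right:
  assumes "u \<in> homset C X Y" "k \<in> homset C Y Z" "is_mono C (k \<cdot> u)"
  shows "is_mono C u"
  unfolding is_mono_def
proof (intro conjI ballI impI)
  show "u \<in> Arr C" using homsetD(1)[OF assms(1)] .
  fix W f g assume "f \<in> homset C W (Dom C u)" "g \<in> homset C W (Dom C u)" and eq: "u \<cdot> f = u \<cdot> g"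
  then have fg: "f \<in> homset C W X" "g \<in> homset C W X" using homsetD[OF assms(1)] by auto
  have "k \<cdot> u \<cdot> f = k \<cdot> u \<cdot> g"
    using Comp_assoc[OF fg(1) assms(1,2)] Comp_assoc[OF fg(2) assms(1,2)] eq by simp
  then show "f = g"
    using assms(3) fg homset_Obj(1)[OF fg(1)] homsetD[OF Comp_homset[OF assms(1,2)]]
    unfolding is_mono_def by metis
qed

text \<open>The cokernel \<open>c\<close> is itself one of the test morphisms \<open>\<psi>\<close>
  in the image ideal, and every other \<open>\<psi>\<close> factors through \<open>c\<close>.
  Testing against \<open>c\<close> alone is therefore enough.\<close>

lemma Im_ideal_eq_Ker_ideal_cokernel:
  assumes "is_cokernel C f c"
  shows "Im_ideal C f X = Ker_ideal C c X"
proof (intro equalityI subsetI)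
  note c = is_cokernel_homset[OF assms]
  have "c \<in> Coker_ideal C f (Cod C c)" using assms c by (simp add: Coker_ideal_def is_cokernel_def)
  then show "\<phi> \<in> Ker_ideal C c X" if "\<phi> \<in> Im_ideal C f X" for \<phi>
    using that homset_Obj[OF c(1)] homsetD[OF c(1)] by (auto simp: Im_ideal_def Ker_ideal_def)
  fix \<phi> assume "\<phi> \<in> Ker_ideal C c X"
  then have \<phi>: "\<phi> \<in> homset C X (Cod C f)" "c \<cdot> \<phi> = Zero C X (Cod C c)"
    using homsetD[OF c(1)] by (auto simp: Ker_ideal_def)
  have "\<psi> \<cdot> \<phi> = Zero C X Y" if \<psi>: "Y \<in> Obj C" "\<psi> \<in> Coker_ideal C f Y" for Y \<psi>
  proof -
    obtain h where h: "h \<in> homset C (Cod C c) Y" "h \<cdot> c = \<psi>"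
      using assms \<psi> unfolding is_cokernel_def Coker_ideal_def by blast
    then have "\<psi> \<cdot> \<phi> = h \<cdot> (c \<cdot> \<phi>)" using Comp_assoc[OF \<phi>(1) c(1) h(1)] by simp
    then show ?thesis using \<phi>(2) Comp_Zero[OF h(1) homset_Obj(1)[OF \<phi>(1)]] by simp
  qed
  then show "\<phi> \<in> Im_ideal C f X" using \<phi>(1) by (simp add: Im_ideal_def)
qed

section \<open>Lifting morphisms through a kernel\<close>

text \<open>The source of the lift is read off \<open>\<phi>\<close>, so neither an object nor the
  morphism of which \<open>k\<close> is a kernel has to be passed. The value is meaningful when
  \<open>\<phi>\<close> has a unique lift, as it does on the kernel ideal.\<close>

definition kernel_lift :: "'m \<Rightarrow> 'm \<Rightarrow> 'm" where
  "kernel_lift k \<phi> = (THE h. h \<in> homset C (Dom C \<phi>) (Dom C k) \<and> k \<cdot> h = \<phi>)"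

lemma kernel_lift:
  assumes "is_kernel C f k" "\<phi> \<in> Ker_ideal C f X"
  shows "kernel_lift k \<phi> \<in> homset C X (Dom C k)" "k \<cdot> kernel_lift k \<phi> = \<phi>"
proof -
  have "Dom C \<phi> = X" using assms(2) by (auto simp: Ker_ideal_def homset_def)
  then show "kernel_lift k \<phi> \<in> homset C X (Dom C k)" "k \<cdot> kernel_lift k \<phi> = \<phi>"
    using theI'[OF kernel_ex1[OF assms]] by (auto simp: kernel_lift_def)
qed

lemma kernel_lift_Comp:
  assumes "is_kernel C f k" "h \<in> homset C X (Dom C k)"
  shows "kernel_lift k (k \<cdot> h) = h"
proof -
  note kh = kernel_Comp[OF assms]
  show ?thesis using kernel_ex1[OF assms(1) kh] kernel_lift[OF assms(1) kh] assms(2) by blast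
qed

text \<open>Both sides yield the same morphism after composition with \<open>k\<close>, and lifts
  through \<open>k\<close> are unique. Compatibility with precomposition follows in the same
  way.\<close>

lemma kernel_lift_Plus:
  assumes k: "is_kernel C f k" and "\<phi> \<in> Ker_ideal C f X" "\<psi> \<in> Ker_ideal C f X"
  shows "kernel_lift k (Plus C \<phi> \<psi>) = Plus C (kernel_lift k \<phi>) (kernel_lift k \<psi>)"
proof -
  note l = kernel_lift[OF k assms(2)] kernel_lift[OF k assms(3)]
  have "k \<cdot> Plus C (kernel_lift k \<phi>) (kernel_lift k \<psi>) = Plus C \<phi> \<psi>"
    using Comp_Plus_right[OF l(1,3) is_kernel_homset(1)[OF k]] l by simp
  moreover interpret comm_group "Hom_group C X (Dom C k)"
    using Hom_comm_group homset_Obj[OF l(1)] by simp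
  have "Plus C (kernel_lift k \<phi>) (kernel_lift k \<psi>) \<in> homset C X (Dom C k)"
    using m_closed l by simp
  ultimately show ?thesis using kernel_lift_Comp[OF k] by metis
qed

lemma kernel_lift_precomp:
  assumes k: "is_kernel C f k" and "\<phi> \<in> Ker_ideal C f Y" "g \<in> homset C X Y"
  shows "kernel_lift k (\<phi> \<cdot> g) = kernel_lift k \<phi> \<cdot> g"
proof -
  note l = kernel_lift[OF k assms(2)]
  have "k \<cdot> (kernel_lift k \<phi> \<cdot> g) = \<phi> \<cdot> g"
    using Comp_assoc[OF assms(3) l(1) is_kernel_homset(1)[OF k]] l by simp
  then show ?thesis using kernel_lift_Comp[OF k Comp_homset[OF assms(3) l(1)]] by metis
qed

end

section \<open>Monomorphisms as kernels of their cokernels\<close>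

context abelian_category
begin

text \<open>Some \<open>f\<close> has \<open>u\<close> as its kernel. Since \<open>f\<close> kills
  \<open>u\<close>, it factors as \<open>h \<cdot> p\<close>, so whatever \<open>p\<close> kills is
  also killed by \<open>f\<close> and hence lifts uniquely through \<open>u\<close>.\<close>

lemma mono_is_kernel_of_cokernel:
  assumes "is_mono C u" "is_cokernel C u p"
  shows "is_kernel C p u"
proof -
  note p = is_cokernel_homset[OF assms(2)]
  obtain f where f: "is_kernel C f u" using mono_is_kernel assms(1) by blast
  note F = is_kernel_homset[OF f]
  have dom: "Dom C f = Cod C u" "Dom C p = Cod C u" using homsetD[OF F(1)] homsetD[OF p(1)] by auto
  obtain h where h: "h \<in> homset C (Cod C p) (Cod C f)" "h \<cdot> p = f"
    using assms(2) f F homset_Obj[OF F(2)] dom unfolding is_cokernel_def is_kernel_def by metis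
  have "g \<in> Ker_ideal C f X" if "g \<in> Ker_ideal C p X" for g X
  proof -
    have g: "g \<in> homset C X (Cod C u)" "p \<cdot> g = Zero C X (Cod C p)"
      using that dom by (auto simp: Ker_ideal_def)
    have "f \<cdot> g = h \<cdot> (p \<cdot> g)" using Comp_assoc[OF g(1) p(1) h(1)] h(2) by simp
    then show ?thesis
      using g dom Comp_Zero[OF h(1) homset_Obj(1)[OF g(1)]] by (simp add: Ker_ideal_def)
  qed
  then have "\<exists>!h. h \<in> homset C X (Dom C u) \<and> u \<cdot> h = g" if "g \<in> Ker_ideal C p X" for g X
    using kernel_ex1[OF f] that by blast
  then show ?thesis
    using assms(2) dom unfolding is_kernel_def is_cokernel_def Ker_ideal_def by auto
qed

section \<open>The comparison isomorphism on projective objects\<close>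

lemma right_homology_isomorphic:
  assumes ch: "chain_complex C Ch d" and "is_homology_object C d n H"
  shows "Ab_presheaf_isomorphic (full_subcategory C {P. projective C P})
    (right_homology C d n) (Hom_presheaf C H)"
proof -
  obtain k c m u p where k: "is_kernel C (d n) k" and c: "is_cokernel C (d (n + 1)) c"
    and m: "is_kernel C c m" and u: "u \<in> homset C (Dom C m) (Dom C k)" "k \<cdot> u = m"
    and p: "is_cokernel C u p" and H: "Cod C p = H"
    using assms(2) unfolding is_homology_object_def by blast
  have d: "d n \<in> homset C (Ch n) (Ch (n - 1))" "d (n + 1) \<in> homset C (Ch (n + 1)) (Ch n)"
    using ch spec[of "\<lambda>n. d n \<in> homset C (Ch n) (Ch (n - 1))" "n + 1"]
    by (auto simp: chain_complex_def)
  note D = homsetD[OF d(1)] homsetD[OF d(2)]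
  have Ch: "Ch n \<in> Obj C" using d homset_Obj by blast
  have kA: "k \<in> homset C (Dom C k) (Ch n)" using is_kernel_homset(1)[OF k] D by simp
  have pA: "p \<in> homset C (Dom C k) H" using is_cokernel_homset(1)[OF p] H homsetD[OF u(1)] by simp
  have HO: "H \<in> Obj C" using homset_Obj[OF pA] by simp
  \<comment> \<open>The kernel \<open>m = k \<cdot> u\<close> is monic, hence so is
    \<open>u\<close>, and a monomorphism is the kernel of its cokernel.\<close>
  have up: "is_kernel C p u"
    using is_mono_Comp_right[OF u(1) kA] is_kernel_mono[OF m] u(2) mono_is_kernel_of_cokernel p
    by simp
  define \<Phi> where "\<Phi> \<phi> = p \<cdot> kernel_lift k \<phi>" for \<phi>
  \<comment> \<open>This is the map on cosets induced by \<open>\<Phi>\<close>, in the form in which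
    \<open>FactGroup_iso_set\<close> provides it. The object \<open>X\<close> enters only as the
    index of the component.\<close>
  define \<eta> where "\<eta> (X :: 'o) K = the_elem (\<Phi> ` K)" for X K
  let ?I = "Im_ideal C (d (n + 1))" and ?K = "Ker_ideal C (d n)"
  let ?G = "\<lambda>X. Hom_group C X (Ch n)"
  let ?S = "\<lambda>X. (?G X)\<lparr>carrier := ?K X\<rparr>"
  let ?F = "right_homology C d n"
  have FObj: "FObj ?F X = ?S X Mod ?I X" for X using D by (simp add: right_homology_def)
  have \<Phi>: "\<Phi> \<phi> \<in> homset C X H" if "\<phi> \<in> ?K X" for \<phi> X
    unfolding \<Phi>_def using Comp_homset[OF kernel_lift(1)[OF k that] pA] .
  have hom: "group_hom (?S X) (Hom_group C X H) \<Phi>" if X: "X \<in> Obj C" for X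
  proof -
    have "subgroup (?K X) (?G X)" using Ker_ideal_subgroup[OF D(1) X] D by simp
    then have "group (?S X)"
      using subgroup.subgroup_is_group comm_group.axioms(2)[OF Hom_comm_group[OF X Ch]] by blast
    moreover have "group (Hom_group C X H)"
      using comm_group.axioms(2)[OF Hom_comm_group[OF X HO]] .
    moreover have "\<Phi> \<in> hom (?S X) (Hom_group C X H)"
    proof (rule homI)
      fix \<phi> \<psi> assume "\<phi> \<in> carrier (?S X)" "\<psi> \<in> carrier (?S X)"
      then have *: "\<phi> \<in> ?K X" "\<psi> \<in> ?K X" by auto
      show "\<Phi> (\<phi> \<otimes>\<^bsub>?S X\<^esub> \<psi>) = \<Phi> \<phi> \<otimes>\<^bsub>Hom_group C X H\<^esub> \<Phi> \<psi>"
        using kernel_lift_Plus[OF k *]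
          Comp_Plus_right[OF kernel_lift(1)[OF k *(1)] kernel_lift(1)[OF k *(2)] pA]
        by (simp add: \<Phi>_def)
    qed (use \<Phi> in auto)
    ultimately show ?thesis by (simp add: group_hom_def group_hom_axioms_def)
  qed
  have ker: "kernel (?S X) (Hom_group C X H) \<Phi> = ?I X" if X: "X \<in> Obj C" for X
  proof -
    have "\<phi> \<in> ?I X \<longleftrightarrow> \<phi> \<in> ?K X \<and> \<Phi> \<phi> = Zero C X H" for \<phi>
    proof
      assume I: "\<phi> \<in> ?I X"
      then have "\<phi> \<in> Ker_ideal C c X" using Im_ideal_eq_Ker_ideal_cokernel[OF c] by simp
      from kernel_lift[OF m this] obtain g where g: "g \<in> homset C X (Dom C m)" "m \<cdot> g = \<phi>" by blast
      have ug: "u \<cdot> g \<in> homset C X (Dom C k)" using Comp_homset[OF g(1) u(1)] .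
      \<comment> \<open>By uniqueness the lift of \<open>\<phi>\<close> through \<open>k\<close> is
        \<open>u \<cdot> g\<close>, and \<open>p\<close> kills \<open>u\<close>.\<close>
      have "\<phi> = k \<cdot> (u \<cdot> g)" using Comp_assoc[OF g(1) u(1) kA] u g by simp
      then have "\<Phi> \<phi> = p \<cdot> (u \<cdot> g)" using kernel_lift_Comp[OF k ug] by (simp add: \<Phi>_def)
      also have "\<dots> = Zero C X H"
        using kernel_Comp[OF up, of g X] g homsetD[OF u(1)] H by (simp add: Ker_ideal_def)
      finally show "\<phi> \<in> ?K X \<and> \<Phi> \<phi> = Zero C X H"
        using Im_ideal_subset_Ker_ideal[OF ch X] I by blast
    next
      assume *: "\<phi> \<in> ?K X \<and> \<Phi> \<phi> = Zero C X H"
      then have "\<phi> \<in> ?K X" by simp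
      note l = kernel_lift[OF k this]
      \<comment> \<open>Conversely, a lift killed by \<open>p\<close> factors through its kernel
        \<open>u\<close>, so \<open>\<phi>\<close> factors through
        \<open>k \<cdot> u = m\<close>.\<close>
      have "kernel_lift k \<phi> \<in> Ker_ideal C p X"
        using * l homsetD[OF pA] by (simp add: \<Phi>_def Ker_ideal_def)
      from kernel_lift[OF up this] obtain g
        where "g \<in> homset C X (Dom C u)" "u \<cdot> g = kernel_lift k \<phi>" by blast
      then have g: "g \<in> homset C X (Dom C m)" "u \<cdot> g = kernel_lift k \<phi>"
        using homsetD[OF u(1)] by auto
      have "\<phi> = m \<cdot> g" using Comp_assoc[OF g(1) u(1) kA] u g l by simp
      then show "\<phi> \<in> ?I X"
        using kernel_Comp[OF m g(1)] Im_ideal_eq_Ker_ideal_cokernel[OF c] by simp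
    qed
    then show ?thesis by (auto simp: kernel_def)
  qed
  \<comment> \<open>Projectivity enters here: it lifts \<open>g\<close> along the epimorphism
    \<open>p\<close> to some \<open>h\<close>, and \<open>k \<cdot> h\<close> is a preimage of
    \<open>g\<close>.\<close>
  have surj: "\<Phi> ` ?K P = homset C P H" if P: "projective C P" for P
  proof (intro equalityI subsetI)
    show "g \<in> \<Phi> ` ?K P" if g: "g \<in> homset C P H" for g
    proof -
      obtain h where h: "h \<in> homset C P (Dom C k)" "p \<cdot> h = g"
        using P g is_cokernel_epi[OF p] homsetD[OF pA] unfolding projective_def by metis
      then have "g = \<Phi> (k \<cdot> h)" using kernel_lift_Comp[OF k h(1)] by (simp add: \<Phi>_def)
      then show ?thesis using kernel_Comp[OF k h(1)] by blast
    qed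
  qed (use \<Phi> in auto)
  \<comment> \<open>On a coset of its kernel \<open>\<Phi>\<close> is constant. The coset is
    nonempty because the ideal contains zero, so its image is a singleton and
    \<open>the_elem\<close> returns the common value.\<close>
  have \<eta>_coset: "\<eta> X (?I X #>\<^bsub>?G X\<^esub> \<phi>) = \<Phi> \<phi>" if \<phi>: "\<phi> \<in> ?K X" for X \<phi>
  proof -
    have X: "X \<in> Obj C" using \<phi> homset_Obj by (auto simp: Ker_ideal_def)
    interpret group_hom "?S X" "Hom_group C X H" \<Phi> by (rule hom[OF X])
    have I: "subgroup (?I X) (?S X)" using subgroup_kernel ker[OF X] by simp
    have "\<Phi> (Plus C \<psi> \<phi>) = \<Phi> \<phi>" if "\<psi> \<in> ?I X" for \<psi>
    proof -
      have "\<psi> \<in> ?K X" "\<Phi> \<psi> = Zero C X H" using that ker[OF X] by (auto simp: kernel_def)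
      then show ?thesis using hom_mult[of \<psi> \<phi>] H.l_one[of "\<Phi> \<phi>"] \<phi> \<Phi>[OF \<phi>] by simp
    qed
    then have "\<Phi> ` (?I X #>\<^bsub>?G X\<^esub> \<phi>) = {\<Phi> \<phi>}"
      using subgroup.one_closed[OF I] by (auto simp: r_coset_def image_UN)
    then show ?thesis by (simp add: \<eta>_def)
  qed
  have "Ab_presheaf_iso (full_subcategory C {P. projective C P}) ?F (Hom_presheaf C H) \<eta>"
  proof (intro Ab_presheaf_iso.intro Ab_presheaf.Ab_presheaf_full_subcategory
      Ab_presheaf_iso_axioms.intro right_homology_presheaf[OF ch] Hom_presheaf_presheaf[OF HO])
    fix X assume "X \<in> Obj (full_subcategory C {P. projective C P})"
    then have X: "X \<in> Obj C" "projective C X" by auto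
    have "\<Phi> ` carrier (?S X) = carrier (Hom_group C X H)" using surj[OF X(2)] by simp
    from group_hom.FactGroup_iso_set[OF hom[OF X(1)] this]
    have "(\<lambda>K. the_elem (\<Phi> ` K)) \<in> iso (?S X Mod ?I X) (Hom_group C X H)"
      unfolding ker[OF X(1)] .
    moreover have "\<eta> X = (\<lambda>K. the_elem (\<Phi> ` K))" by (rule ext) (rule \<eta>_def)
    moreover have "FObj (Hom_presheaf C H) X = Hom_group C X H" by (simp add: Hom_presheaf_def)
    ultimately show "\<eta> X \<in> iso (FObj ?F X) (FObj (Hom_presheaf C H) X)"
      by (simp only: FObj)
  next
    fix f X Y K assume "f \<in> homset (full_subcategory C {P. projective C P}) X Y"
      and "K \<in> carrier (FObj ?F Y)"
    \<comment> \<open>Cosets formed in \<open>?S Y\<close> and in \<open>?G Y\<close> coincide,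
      since restricting the carrier leaves the addition unchanged; unfolding
      \<open>r_coset_def\<close> makes this visible.\<close>
    then obtain \<phi> where f: "f \<in> homset C X Y" and \<phi>: "\<phi> \<in> ?K Y"
      and K: "K = ?I Y #>\<^bsub>?G Y\<^esub> \<phi>"
      by (auto simp: FObj carrier_FactGroup r_coset_def homset_full_subcategory)
    have "\<phi> \<in> homset C Y (Ch n)" using \<phi> D by (simp add: Ker_ideal_def)
    \<comment> \<open>Naturality is checked on the representative \<open>\<phi>\<close>, as the
      action of \<open>f\<close> sends its coset to the coset of
      \<open>\<phi> \<cdot> f\<close>.\<close>
    then have "\<eta> X (FMor ?F f K) = \<Phi> (\<phi> \<cdot> f)"
      using right_homology_FMor_coset[OF ch f] K \<eta>_coset Ker_ideal_precomp[OF D(1) f \<phi>] by simp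
    also have "\<dots> = \<Phi> \<phi> \<cdot> f"
      using kernel_lift_precomp[OF k \<phi> f] Comp_assoc[OF f kernel_lift(1)[OF k \<phi>] pA]
      by (simp add: \<Phi>_def)
    finally show "\<eta> X (FMor ?F f K) = FMor (Hom_presheaf C H) f (\<eta> Y K)"
      using \<eta>_coset[OF \<phi>] K by (simp add: Hom_presheaf_def)
  qed
  then show ?thesis unfolding Ab_presheaf_isomorphic_def by blast
qed

end

theorem theorem3p1:
  fixes A :: "('o, 'm) preadditive" and Ch :: "int \<Rightarrow> 'o" and d :: "int \<Rightarrow> 'm"
  assumes "abelian_category A" and "chain_complex A Ch d"
  shows "\<forall>n H. is_homology_object A d n H \<longrightarrow>
    Ab_presheaf_isomorphic (full_subcategory A {P. projective A P})
      (right_homology A d n) (Hom_presheaf A H)"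
  using abelian_category.right_homology_isomorphic[OF assms] by blast

end
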